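(* Let $C=\prod_{i=1}^d[l_i,u_i]\subset\mathbb{R}^d$ and let $f:C\to\mathbb{R}$ be a function with a global minimizer $x^*$ on $C$ such that, for some constants $L,\mu>0$, $$\frac{\mu}{2}\|x-x^*\|^2\le f(x)-f(x^* )\le\frac{L}{2}\|x-x^*\|^2\qquad\text{for all }x\in C,$$ where $\|\cdot\|$ is the Euclidean norm. Let $\alpha>1$. Then the Multi BBS algorithm with parameter $\alpha$ (described in the context) requires $\mathcal{O}\left(\log_\alpha(1/\varepsilon)\right)$ iterations to find a solution (in the sense of the algorithm's stopping criterion with accuracy $\varepsilon$). Moreover, the oracle complexity (number of evaluations of $f$) of each iteration is $\mathcal{O}\left(\left(\alpha\sqrt{dL/\mu}\right)^d\right)$.
   Context: Multi BBS algorithm with parameter $\alpha$. Input: accuracy $\varepsilon$, the constants $L,\mu$, and the bounds $l=(l_1,\dots,l_d)$, $u=(u_1,\dots,u_d)$. Set $n:=\alpha\left\lceil\sqrt{dL/\mu}\right\rceil$, $b:=l$, $B:=u$. The current box (cube, possibly with edges of unequal length) is $\prod_{j=1}^d[b_j,B_j]$. While $\|B-b\|\ge\varepsilon$, perform the following iteration: 1. $r:=\max_{i\in\{1,\dots,d\}}(B_i-b_i)/n$. 2. $S_j:=\{0,1,\dots,\lfloor (B_j-b_j)/r\rfloor\}$ for each $j$, and $S:=S_1\times\dots\times S_d$. 3. $i^*:=\arg\min_{i\in S}f(b+i\cdot r)$. 4. For all $j\in\{1,\dots,d\}$ simultaneously, with $b_j,B_j$ on the right-hand sides denoting the values before the update,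 replace $b_j$ by $\max\left(b_j,\ b_j+\left(i^*_j-\frac{n}{2\alpha}\right)r\right)$ and $B_j$ by $\min\left(B_j,\ b_j+\left(i^*_j+\frac{n}{2\alpha}\right)r\right)$. Output: the center $(B+b)/2$ of the final box. The algorithm uses only values of $f$ (zeroth-order oracle); no convexity, smoothness or differentiability of $f$ is assumed. *)

theory Defs
  imports "HOL-Analysis.Analysis"
begin

text \<open>
  The hypotheses on the objective. A function on the box is modelled by a total function of which
  only the values on \<^term>\<open>cbox l u\<close> matter; membership of the minimizer makes the box nonempty.
\<close>

definition quadratic_growth_min ::
    "(real ^ 'n \<Rightarrow> real) \<Rightarrow> real ^ 'n \<Rightarrow> real ^ 'n \<Rightarrow> real ^ 'n \<Rightarrow> real \<Rightarrow> real \<Rightarrow> bool" where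
  "quadratic_growth_min f l u xstar L \<mu> \<longleftrightarrow>
     xstar \<in> cbox l u \<and> (\<forall>x\<in>cbox l u. f xstar \<le> f x) \<and> 0 < L \<and> 0 < \<mu> \<and>
     (\<forall>x\<in>cbox l u. \<mu> / 2 * (norm (x - xstar))\<^sup>2 \<le> f x - f xstar \<and>
                   f x - f xstar \<le> L / 2 * (norm (x - xstar))\<^sup>2)"

text \<open>The number \<open>n\<close> of the algorithm is a real number, since \<open>\<alpha>\<close> need not be an integer.\<close>

definition bbs_n :: "nat \<Rightarrow> real \<Rightarrow> real \<Rightarrow> real \<Rightarrow> real" where
  "bbs_n d L \<mu> \<alpha> = \<alpha> * of_int \<lceil>sqrt (real d * L / \<mu>)\<rceil>"

definition bbs_mesh :: "real \<Rightarrow> real \<Rightarrow> real \<Rightarrow> real ^ 'n \<Rightarrow> real ^ 'n \<Rightarrow> real" where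
  "bbs_mesh L \<mu> \<alpha> b B = (MAX j. (B $ j - b $ j) / bbs_n CARD('n) L \<mu> \<alpha>)"

text \<open>
  The index set \<open>S = S\<^sub>1 \<times> \<dots> \<times> S\<^sub>d\<close>. In one iteration the objective is evaluated once per index,
  so the number of oracle calls is the cardinality of this set.
\<close>

definition bbs_indices :: "real \<Rightarrow> real ^ 'n \<Rightarrow> real ^ 'n \<Rightarrow> (int ^ 'n) set" where
  "bbs_indices r b B = {i. \<forall>j. i $ j \<in> {0..\<lfloor>(B $ j - b $ j) / r\<rfloor>}}"

definition bbs_oracle_calls :: "real \<Rightarrow> real \<Rightarrow> real \<Rightarrow> real ^ 'n \<Rightarrow> real ^ 'n \<Rightarrow> nat" where
  "bbs_oracle_calls L \<mu> \<alpha> b B = card (bbs_indices (bbs_mesh L \<mu> \<alpha> b B) b B)"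

definition bbs_point :: "real \<Rightarrow> real ^ 'n \<Rightarrow> int ^ 'n \<Rightarrow> real ^ 'n" where
  "bbs_point r b i = (\<chi> j. b $ j + of_int (i $ j) * r)"

text \<open>
  One pass through the loop body, from the box \<open>(b, B)\<close> to the box \<open>(b', B')\<close>. It is a relation
  because the grid minimizer need not be unique: any tie-breaking is allowed.
\<close>

definition bbs_step ::
    "(real ^ 'n \<Rightarrow> real) \<Rightarrow> real \<Rightarrow> real \<Rightarrow> real \<Rightarrow> real ^ 'n \<Rightarrow> real ^ 'n \<Rightarrow> real ^ 'n \<Rightarrow> real ^ 'n \<Rightarrow> bool"
  where
  "bbs_step f L \<mu> \<alpha> b B b' B' \<longleftrightarrow>
     (let n = bbs_n CARD('n) L \<mu> \<alpha>; r = bbs_mesh L \<mu> \<alpha> b B in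
      \<exists>i. is_arg_min (\<lambda>i. f (bbs_point r b i)) (\<lambda>i. i \<in> bbs_indices r b B) i \<and>
          b' = (\<chi> j. max (b $ j) (b $ j + (of_int (i $ j) - n / (2 * \<alpha>)) * r)) \<and>
          B' = (\<chi> j. min (B $ j) (b $ j + (of_int (i $ j) + n / (2 * \<alpha>)) * r)))"

text \<open>
  An execution is recorded by the sequences of lower and upper corners of the current box,
  continued constantly once the loop guard \<open>\<epsilon> \<le> norm (B - b)\<close> fails.
\<close>

definition bbs_execution ::
    "(real ^ 'n \<Rightarrow> real) \<Rightarrow> real \<Rightarrow> real \<Rightarrow> real \<Rightarrow> real \<Rightarrow> real ^ 'n \<Rightarrow> real ^ 'n \<Rightarrow>
     (nat \<Rightarrow> real ^ 'n) \<Rightarrow> (nat \<Rightarrow> real ^ 'n) \<Rightarrow> bool" where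
  "bbs_execution f L \<mu> \<alpha> \<epsilon> l u b B \<longleftrightarrow>
     b 0 = l \<and> B 0 = u \<and>
     (\<forall>k. if \<epsilon> \<le> norm (B k - b k)
          then bbs_step f L \<mu> \<alpha> (b k) (B k) (b (Suc k)) (B (Suc k))
          else b (Suc k) = b k \<and> B (Suc k) = B k)"

definition bbs_halts_after :: "real \<Rightarrow> (nat \<Rightarrow> real ^ 'n) \<Rightarrow> (nat \<Rightarrow> real ^ 'n) \<Rightarrow> nat \<Rightarrow> bool" where
  "bbs_halts_after \<epsilon> b B N \<longleftrightarrow>
     (\<forall>k<N. \<epsilon> \<le> norm (B k - b k)) \<and> norm (B N - b N) < \<epsilon>"

text \<open>
  The algorithm is never stuck: the grids are finite and nonempty, so executions exist from every
  nonempty box.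
\<close>

lemma finite_bbs_indices: "finite (bbs_indices r b (B :: real ^ 'n))"
proof -
  let ?T = "PiE UNIV (\<lambda>j. {0..\<lfloor>(B $ j - b $ j) / r\<rfloor>})"
  have "bbs_indices r b B \<subseteq> (\<lambda>g. \<chi> j. g j) ` ?T"
  proof
    fix i assume "i \<in> bbs_indices r b B"
    then have "($) i \<in> ?T" by (auto simp: bbs_indices_def)
    moreover have "i = (\<chi> j. i $ j)" by simp
    ultimately show "i \<in> (\<lambda>g. \<chi> j. g j) ` ?T" by blast
  qed
  moreover have "finite ?T" by (intro finite_PiE) auto
  ultimately show ?thesis by (meson finite_imageI finite_subset)
qed

lemma bbs_step_exists:
  fixes b B :: "real ^ 'n"
  assumes le: "\<And>j. b $ j \<le> B $ j" and pos: "0 < L" "0 < \<mu>" "1 < \<alpha>"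
  obtains b' B' where "bbs_step f L \<mu> \<alpha> b B b' B'" and "\<And>j. b' $ j \<le> B' $ j"
proof -
  define n r where "n = bbs_n CARD('n) L \<mu> \<alpha>" and "r = bbs_mesh L \<mu> \<alpha> b B"
  have "0 \<le> sqrt (real CARD('n) * L / \<mu>)" using pos by simp
  then have "0 \<le> \<lceil>sqrt (real CARD('n) * L / \<mu>)\<rceil>"
    by (simp add: le_ceiling_iff order_less_le_trans[of "-1" 0])
  then have n0: "0 \<le> n"
    using pos by (simp add: n_def bbs_n_def)
  have r0: "0 \<le> r"
  proof -
    have "(B $ undefined - b $ undefined) / n \<le> r"
      unfolding r_def bbs_mesh_def n_def by (rule Max_ge) auto
    moreover have "0 \<le> (B $ undefined - b $ undefined) / n" using le n0 by simp
    ultimately show ?thesis by linarith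
  qed
  have "0 \<in> bbs_indices r b B"
    using le r0 by (simp add: bbs_indices_def)
  then have "bbs_indices r b B \<noteq> {}" by blast
  then obtain i where i: "is_arg_min (\<lambda>i. f (bbs_point r b i)) (\<lambda>i. i \<in> bbs_indices r b B) i"
    using ex_is_arg_min_if_finite[OF finite_bbs_indices] by metis
  define b' B' :: "real ^ 'n" where
    "b' = (\<chi> j. max (b $ j) (b $ j + (of_int (i $ j) - n / (2 * \<alpha>)) * r))" and
    "B' = (\<chi> j. min (B $ j) (b $ j + (of_int (i $ j) + n / (2 * \<alpha>)) * r))"
  have "bbs_step f L \<mu> \<alpha> b B b' B'"
    unfolding bbs_step_def Let_def n_def[symmetric] r_def[symmetric] b'_def B'_def
    using i by blast
  moreover have "b' $ j \<le> B' $ j" for j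
  proof -
    have "0 \<le> i $ j" and le_fl: "i $ j \<le> \<lfloor>(B $ j - b $ j) / r\<rfloor>"
      using i by (auto simp: is_arg_min_def bbs_indices_def)
    then have lo: "0 \<le> of_int (i $ j) * r" using r0 by simp
    have "of_int (i $ j) \<le> (B $ j - b $ j) / r" using le_fl by (simp add: le_floor_iff)
    then have hi: "of_int (i $ j) * r \<le> B $ j - b $ j"
      using r0 le[of j] by (cases "r = 0") (auto simp: field_simps)
    have "0 \<le> n / (2 * \<alpha>) * r" using n0 r0 pos by simp
    then show ?thesis using lo hi le[of j] by (simp add: b'_def B'_def algebra_simps)
  qed
  ultimately show thesis by (rule that)
qed

lemma bbs_execution_exists:
  fixes l u :: "real ^ 'n"
  assumes "\<And>j. l $ j \<le> u $ j" and pos: "0 < L" "0 < \<mu>" "1 < \<alpha>"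
  shows "\<exists>b B. bbs_execution f L \<mu> \<alpha> \<epsilon> l u b B"
proof -
  let ?P = "\<lambda>(k::nat) (s :: (real ^ 'n) \<times> (real ^ 'n)).
              (\<forall>j. fst s $ j \<le> snd s $ j) \<and> (k = 0 \<longrightarrow> s = (l, u))"
  let ?Q = "\<lambda>(k::nat) s t. if \<epsilon> \<le> norm (snd s - fst s)
              then bbs_step f L \<mu> \<alpha> (fst s) (snd s) (fst t) (snd t)
              else fst t = fst s \<and> snd t = snd s"
  have "\<exists>s. \<forall>k. ?P k (s k) \<and> ?Q k (s k) (s (Suc k))"
  proof (rule dependent_nat_choice)
    show "\<exists>s. ?P 0 s" using assms(1) by auto
  next
    fix s k assume P: "?P k s"
    show "\<exists>t. ?P (Suc k) t \<and> ?Q k s t"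
    proof (cases "\<epsilon> \<le> norm (snd s - fst s)")
      case True
      obtain b' B' where "bbs_step f L \<mu> \<alpha> (fst s) (snd s) b' B'" "\<And>j. b' $ j \<le> B' $ j"
        using bbs_step_exists[of "fst s" "snd s" L \<mu> \<alpha> f] P pos by blast
      then show ?thesis using True by (intro exI[of _ "(b', B')"]) simp
    next
      case False
      then show ?thesis using P by (intro exI[of _ s]) simp
    qed
  qed
  then obtain s where s: "\<And>k. ?P k (s k) \<and> ?Q k (s k) (s (Suc k))" by blast
  have "bbs_execution f L \<mu> \<alpha> \<epsilon> l u (fst \<circ> s) (snd \<circ> s)"
    using s s[of 0] by (simp add: bbs_execution_def)
  then show ?thesis by blast
qed

end

theory Submission
  imports Defs
begin

text \<open>
  Both bounds rest on the same two elementary observations about a single pass through the loop.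

  Let \<open>w\<close> be the longest edge of the current box, so that the mesh is \<open>r = w / n\<close>. Whatever grid point
  is selected, the new box lies in a cube of edge length \<open>(n / \<alpha>) r = w / \<alpha>\<close> around it, so the longest
  edge shrinks at least by the factor \<open>\<alpha>\<close> (\<open>bbs_step_contracts\<close>). Hence as long as the loop
  runs, the diameter of the \<open>k\<close>-th box is at most \<open>D / \<alpha> ^ k\<close> with \<open>D\<close> depending on the initial box
  only; the pass with index \<open>N - 1\<close> is entered only if \<open>\<epsilon> \<le> D / \<alpha> ^ (N - 1)\<close>, and for \<open>\<epsilon>\<close> small the
  factor \<open>\<alpha> D\<close> is absorbed by a second factor \<open>1 / \<epsilon>\<close>. This gives the constant 2.

  No edge is longer than \<open>w = n r\<close>, so the grid has at most \<open>n + 1\<close> points in each direction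
  (\<open>bbs_oracle_calls_le\<close>). To compare \<open>n + 1\<close> with \<open>s = sqrt (d L / \<mu>)\<close> itself, and so
  to remove the rounding, \<open>s\<close> must be bounded below. If the loop is entered, then the box has a point
  other than the minimizer; there the two quadratic bounds give \<open>\<mu> \<le> L\<close>, and therefore \<open>1 \<le> s\<close> and
  \<open>n + 1 \<le> 3 \<alpha> s\<close>. This gives the constant \<open>3 ^ d\<close>.
\<close>

section \<open>One pass through the loop\<close>

lemma bbs_n_pos:
  assumes "0 < d" "0 < L" "0 < \<mu>" "0 < \<alpha>"
  shows "0 < bbs_n d L \<mu> \<alpha>"
proof -
  have "0 < sqrt (real d * L / \<mu>)" using assms by simp
  then have "0 < \<lceil>sqrt (real d * L / \<mu>)\<rceil>" by simp
  then show ?thesis using assms unfolding bbs_n_def by (intro mult_pos_pos) auto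
qed

lemma edge_le_bbs_mesh:
  fixes b B :: "real ^ 'n"
  shows "(B $ j - b $ j) / bbs_n CARD('n) L \<mu> \<alpha> \<le> bbs_mesh L \<mu> \<alpha> b B"
  unfolding bbs_mesh_def by (rule Max_ge) auto

lemma bbs_mesh_nonneg:
  fixes b B :: "real ^ 'n"
  assumes "\<And>j. b $ j \<le> B $ j" "0 < bbs_n CARD('n) L \<mu> \<alpha>"
  shows "0 \<le> bbs_mesh L \<mu> \<alpha> b B"
proof -
  have "0 \<le> (B $ undefined - b $ undefined) / bbs_n CARD('n) L \<mu> \<alpha>"
    using assms by simp
  then show ?thesis using edge_le_bbs_mesh order_trans by blast
qed

lemma bbs_mesh_le:
  fixes b B :: "real ^ 'n"
  assumes "\<And>j. B $ j - b $ j \<le> w" "0 < bbs_n CARD('n) L \<mu> \<alpha>"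
  shows "bbs_mesh L \<mu> \<alpha> b B \<le> w / bbs_n CARD('n) L \<mu> \<alpha>"
  unfolding bbs_mesh_def using assms by (intro Max.boundedI) (auto intro: divide_right_mono)

text \<open>
  The selected grid point lies in the current box, and the new edges are the parts of the old ones
  within distance \<open>n r / (2 \<alpha>)\<close> of it. The first fact keeps the box nonempty, the second bounds its
  edges.
\<close>

lemma bbs_step_contracts:
  fixes b B :: "real ^ 'n"
  assumes step: "bbs_step f L \<mu> \<alpha> b B b' B'"
    and le: "\<And>j. b $ j \<le> B $ j" and w: "\<And>j. B $ j - b $ j \<le> w"
    and n0: "0 < bbs_n CARD('n) L \<mu> \<alpha>" and \<alpha>: "0 < \<alpha>"
  shows "b' $ j \<le> B' $ j" and "B' $ j - b' $ j \<le> w / \<alpha>"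
proof -
  define n r where "n = bbs_n CARD('n) L \<mu> \<alpha>" and "r = bbs_mesh L \<mu> \<alpha> b B"
  have n: "0 < n" using n0 by (simp add: n_def)
  have r0: "0 \<le> r" unfolding r_def using bbs_mesh_nonneg le n0 by blast
  have r: "r \<le> w / n" unfolding r_def n_def using bbs_mesh_le w n0 by blast
  obtain i where i: "i \<in> bbs_indices r b B"
    and b': "b' = (\<chi> j. max (b $ j) (b $ j + (of_int (i $ j) - n / (2 * \<alpha>)) * r))"
    and B': "B' = (\<chi> j. min (B $ j) (b $ j + (of_int (i $ j) + n / (2 * \<alpha>)) * r))"
    using step unfolding bbs_step_def Let_def n_def r_def by (auto simp: is_arg_min_def)
  have "0 \<le> i $ j" and i_le: "i $ j \<le> \<lfloor>(B $ j - b $ j) / r\<rfloor>"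
    using i by (auto simp: bbs_indices_def)
  then have lo: "0 \<le> of_int (i $ j) * r" using r0 by simp
  have "of_int (i $ j) \<le> (B $ j - b $ j) / r" using i_le by (simp add: le_floor_iff)
  then have hi: "of_int (i $ j) * r \<le> B $ j - b $ j"
    using r0 le[of j] by (cases "r = 0") (auto simp: field_simps)
  have half: "0 \<le> n / (2 * \<alpha>) * r" using n r0 \<alpha> by simp
  show "b' $ j \<le> B' $ j"
    using lo hi half le[of j] by (simp add: b' B' algebra_simps)
  have "B' $ j - b' $ j \<le> 2 * (n / (2 * \<alpha>) * r)"
    by (simp add: b' B' algebra_simps)
  also have "\<dots> = n * r / \<alpha>" by simp
  also have "\<dots> \<le> w / \<alpha>"
    using r n \<alpha> by (intro divide_right_mono) (auto simp: field_simps)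
  finally show "B' $ j - b' $ j \<le> w / \<alpha>" .
qed

section \<open>The number of iterations\<close>

lemma bbs_execution_ordered:
  fixes l u :: "real ^ 'n"
  assumes exec: "bbs_execution f L \<mu> \<alpha> \<epsilon> l u b B"
    and le: "\<And>j. l $ j \<le> u $ j" and n0: "0 < bbs_n CARD('n) L \<mu> \<alpha>" and \<alpha>: "0 < \<alpha>"
  shows "b k $ j \<le> B k $ j"
proof (induction k arbitrary: j)
  case 0
  then show ?case using exec le by (simp add: bbs_execution_def)
next
  case (Suc k)
  show ?case
  proof (cases "\<epsilon> \<le> norm (B k - b k)")
    case True
    then have "bbs_step f L \<mu> \<alpha> (b k) (B k) (b (Suc k)) (B (Suc k))"
      using exec by (auto simp: bbs_execution_def)
    moreover have "B k $ j - b k $ j \<le> norm (B k - b k)" for j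
      using component_le_norm_cart[of "B k - b k" j] by simp
    ultimately show ?thesis using bbs_step_contracts(1) Suc.IH n0 \<alpha> by blast
  next
    case False
    then show ?thesis using exec Suc.IH by (auto simp: bbs_execution_def)
  qed
qed

lemma bbs_execution_edge_le:
  fixes l u :: "real ^ 'n"
  assumes exec: "bbs_execution f L \<mu> \<alpha> \<epsilon> l u b B"
    and le: "\<And>j. l $ j \<le> u $ j" and n0: "0 < bbs_n CARD('n) L \<mu> \<alpha>" and \<alpha>: "0 < \<alpha>"
    and run: "\<And>i. i < k \<Longrightarrow> \<epsilon> \<le> norm (B i - b i)"
  shows "B k $ j - b k $ j \<le> norm (u - l) / \<alpha> ^ k"
  using run
proof (induction k arbitrary: j)
  case 0
  show ?case
    using exec component_le_norm_cart[of "u - l" j] by (simp add: bbs_execution_def)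
next
  case (Suc k)
  have "bbs_step f L \<mu> \<alpha> (b k) (B k) (b (Suc k)) (B (Suc k))"
    using exec Suc.prems by (auto simp: bbs_execution_def)
  moreover have "B k $ j - b k $ j \<le> norm (u - l) / \<alpha> ^ k" for j
    using Suc.IH Suc.prems by simp
  ultimately have "B (Suc k) $ j - b (Suc k) $ j \<le> norm (u - l) / \<alpha> ^ k / \<alpha>"
    using bbs_step_contracts(2) bbs_execution_ordered[OF exec le n0 \<alpha>] n0 \<alpha> by blast
  then show ?case by (simp add: mult.commute)
qed

text \<open>
  Edge lengths control the diameter through \<open>norm x \<le> (\<Sum>j. \<bar>x $ j\<bar>)\<close>. The resulting factor \<open>d\<close>,
  where \<open>sqrt d\<close> would be optimal, only enters a constant that is absorbed later.
\<close>

lemma bbs_execution_norm_le: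
  fixes l u :: "real ^ 'n"
  assumes exec: "bbs_execution f L \<mu> \<alpha> \<epsilon> l u b B"
    and le: "\<And>j. l $ j \<le> u $ j" and n0: "0 < bbs_n CARD('n) L \<mu> \<alpha>" and \<alpha>: "0 < \<alpha>"
    and run: "\<And>i. i < k \<Longrightarrow> \<epsilon> \<le> norm (B i - b i)"
  shows "norm (B k - b k) \<le> real CARD('n) * norm (u - l) / \<alpha> ^ k"
proof -
  have "norm (B k - b k) \<le> (\<Sum>j\<in>UNIV. \<bar>(B k - b k) $ j\<bar>)" by (rule norm_le_l1_cart)
  also have "\<dots> \<le> (\<Sum>j\<in>(UNIV :: 'n set). norm (u - l) / \<alpha> ^ k)"
  proof (rule sum_mono)
    fix j :: 'n
    show "\<bar>(B k - b k) $ j\<bar> \<le> norm (u - l) / \<alpha> ^ k"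
      using bbs_execution_ordered[OF exec le n0 \<alpha>, of k j]
        bbs_execution_edge_le[OF exec le n0 \<alpha> run, of k j] by simp
  qed
  finally show ?thesis by simp
qed

text \<open>
  A quantity that stays below \<open>D / \<alpha> ^ k\<close> while it has not dropped below \<open>\<epsilon>\<close> drops below \<open>\<epsilon>\<close> after
  at most \<open>2 * log \<alpha> (1 / \<epsilon>)\<close> steps: the last index before the drop satisfies
  \<open>\<alpha> ^ (N - 1) \<le> D / \<epsilon>\<close>, and the threshold on \<open>\<epsilon>\<close> makes \<open>\<alpha> D \<le> 1 / \<epsilon>\<close>, and also
  \<open>\<epsilon> \<le> 1\<close>, so that the bound is nonnegative in case \<open>N = 0\<close>.
\<close>

lemma geometric_decay_halting_time:
  fixes g :: "nat \<Rightarrow> real"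
  assumes decay: "\<And>k. (\<And>i. i < k \<Longrightarrow> \<epsilon> \<le> g i) \<Longrightarrow> g k \<le> D / \<alpha> ^ k"
    and \<alpha>: "1 < \<alpha>" and D: "0 \<le> D" and \<epsilon>: "0 < \<epsilon>" "\<epsilon> < 1 / (\<alpha> * D + 1)"
  shows "\<exists>N. (\<forall>k<N. \<epsilon> \<le> g k) \<and> g N < \<epsilon> \<and> real N \<le> 2 * log \<alpha> (1 / \<epsilon>)"
proof -
  have "\<exists>k. g k < \<epsilon>"
  proof (rule ccontr)
    assume "\<nexists>k. g k < \<epsilon>"
    then have ge: "\<epsilon> \<le> g k" for k by (simp add: not_less)
    obtain k where "D / \<epsilon> < \<alpha> ^ k" using real_arch_pow[OF \<alpha>] by blast
    then have "D / \<alpha> ^ k < \<epsilon>" using \<epsilon> \<alpha> by (simp add: field_simps)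
    then show False using decay[of k] ge[of k] ge by auto
  qed
  then obtain N where N: "g N < \<epsilon>" and min: "\<And>k. k < N \<Longrightarrow> \<epsilon> \<le> g k"
    using exists_least_iff[of "\<lambda>k. g k < \<epsilon>"] by (auto simp: not_less)
  have aD: "0 \<le> \<alpha> * D" using \<alpha> D by simp
  have small: "\<epsilon> * (\<alpha> * D + 1) < 1" using \<epsilon> aD by (simp add: field_simps)
  have pow: "\<alpha> ^ N \<le> (1 / \<epsilon>) ^ 2"
  proof (cases N)
    case 0
    have "\<epsilon> \<le> 1" using small mult_nonneg_nonneg[of \<epsilon> "\<alpha> * D"] aD \<epsilon> unfolding distrib_left by linarith
    then have "1 \<le> (1 / \<epsilon>) ^ 2" using \<epsilon> by (intro one_le_power) simp
    then show ?thesis using 0 by simp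
  next
    case (Suc m)
    have "\<epsilon> \<le> D / \<alpha> ^ m" using decay[of m] min[of m] min Suc by fastforce
    then have "\<epsilon> * \<alpha> ^ m \<le> D" using \<alpha> by (simp add: field_simps)
    then have "\<epsilon> * (\<epsilon> * \<alpha> ^ N) \<le> \<epsilon> * (\<alpha> * D)"
      using \<epsilon> \<alpha> Suc by (auto simp: mult.left_commute intro!: mult_left_mono)
    also have "\<dots> \<le> 1" using small \<epsilon> by (simp add: distrib_left)
    finally show ?thesis using \<epsilon> by (simp add: field_simps power2_eq_square)
  qed
  have "real N = log \<alpha> (\<alpha> ^ N)" using \<alpha> by simp
  also have "\<dots> \<le> log \<alpha> ((1 / \<epsilon>) ^ 2)" using pow \<alpha> \<epsilon> by (subst log_le_cancel_iff) auto
  also have "\<dots> = 2 * log \<alpha> (1 / \<epsilon>)" using \<epsilon> by (subst log_nat_power) auto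
  finally show ?thesis using N min by blast
qed

lemma bbs_halting_time:
  fixes l u :: "real ^ 'n"
  assumes exec: "bbs_execution f L \<mu> \<alpha> \<epsilon> l u b B"
    and le: "\<And>j. l $ j \<le> u $ j" and pos: "0 < L" "0 < \<mu>" and \<alpha>: "1 < \<alpha>"
    and \<epsilon>: "0 < \<epsilon>" "\<epsilon> < 1 / (\<alpha> * (real CARD('n) * norm (u - l)) + 1)"
  shows "\<exists>N. bbs_halts_after \<epsilon> b B N \<and> real N \<le> 2 * log \<alpha> (1 / \<epsilon>)"
proof -
  have n0: "0 < bbs_n CARD('n) L \<mu> \<alpha>" using pos \<alpha> by (intro bbs_n_pos) auto
  have "norm (B k - b k) \<le> real CARD('n) * norm (u - l) / \<alpha> ^ k"
    if "\<And>i. i < k \<Longrightarrow> \<epsilon> \<le> norm (B i - b i)" for k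
    using bbs_execution_norm_le[OF exec le n0 _ that] \<alpha> by simp
  from geometric_decay_halting_time[OF this \<alpha> _ \<epsilon>] show ?thesis
    unfolding bbs_halts_after_def by auto
qed

section \<open>The oracle complexity of an iteration\<close>

lemma card_bbs_indices_le:
  fixes b B :: "real ^ 'n"
  assumes "\<And>j. (B $ j - b $ j) / r \<le> m" "0 \<le> m"
  shows "real (card (bbs_indices r b B)) \<le> (m + 1) ^ CARD('n)"
proof -
  let ?S = "\<lambda>j. {0..\<lfloor>(B $ j - b $ j) / r\<rfloor>}"
  let ?T = "PiE (UNIV :: 'n set) ?S"
  have "bbs_indices r b B \<subseteq> (\<lambda>g. \<chi> j. g j) ` ?T"
  proof
    fix i assume "i \<in> bbs_indices r b B"
    then have "($) i \<in> ?T" by (auto simp: bbs_indices_def)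
    moreover have "i = (\<chi> j. i $ j)" by simp
    ultimately show "i \<in> (\<lambda>g. \<chi> j. g j) ` ?T" by blast
  qed
  moreover have "finite ?T" by (intro finite_PiE) auto
  ultimately have "card (bbs_indices r b B) \<le> card ?T"
    by (meson card_image_le card_mono finite_imageI le_trans)
  also have "card ?T = (\<Prod>j\<in>UNIV. card (?S j))" by (rule card_PiE) simp
  finally have "real (card (bbs_indices r b B)) \<le> (\<Prod>j\<in>UNIV. real (card (?S j)))"
    by (metis of_nat_le_iff of_nat_prod)
  also have "\<dots> \<le> (\<Prod>j\<in>(UNIV :: 'n set). m + 1)"
  proof (intro prod_mono conjI)
    fix j :: 'n
    have "real_of_int \<lfloor>(B $ j - b $ j) / r\<rfloor> \<le> m"
      using assms(1)[of j] of_int_floor_le order_trans by blast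
    then show "real (card (?S j)) \<le> m + 1" using assms(2) by simp
  qed simp
  finally show ?thesis by simp
qed

lemma bbs_oracle_calls_le:
  fixes b B :: "real ^ 'n"
  assumes le: "\<And>j. b $ j \<le> B $ j" and n0: "0 < bbs_n CARD('n) L \<mu> \<alpha>"
  shows "real (bbs_oracle_calls L \<mu> \<alpha> b B) \<le> (bbs_n CARD('n) L \<mu> \<alpha> + 1) ^ CARD('n)"
  unfolding bbs_oracle_calls_def
proof (rule card_bbs_indices_le)
  fix j
  \<comment> \<open>On a degenerate box the mesh is 0, and division by 0 leaves the single grid point \<open>b\<close>.\<close>
  show "(B $ j - b $ j) / bbs_mesh L \<mu> \<alpha> b B \<le> bbs_n CARD('n) L \<mu> \<alpha>"
    using bbs_mesh_nonneg[OF le n0] edge_le_bbs_mesh[of B j b L \<mu> \<alpha>] n0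
    by (cases "bbs_mesh L \<mu> \<alpha> b B = 0") (auto simp: field_simps)
qed (use n0 in simp)

text \<open>Evaluate both bounds at a corner of the box other than the minimizer.\<close>

lemma quadratic_growth_min_constants_le:
  assumes q: "quadratic_growth_min f l u xstar L \<mu>" and "l \<noteq> u"
  shows "\<mu> \<le> L"
proof -
  have xs: "xstar \<in> cbox l u" using q by (simp add: quadratic_growth_min_def)
  then have "l \<in> cbox l u" "u \<in> cbox l u"
    by (auto simp: mem_box_cart intro: order_trans)
  with \<open>l \<noteq> u\<close> obtain x where x: "x \<in> cbox l u" "x \<noteq> xstar" by metis
  then have "\<mu> / 2 * (norm (x - xstar))\<^sup>2 \<le> L / 2 * (norm (x - xstar))\<^sup>2"
    using q unfolding quadratic_growth_min_def by (meson order_trans)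
  then show ?thesis using x by (simp add: mult_le_cancel_right)
qed

lemma bbs_n_add_one_le:
  assumes "0 < d" "0 < \<mu>" "\<mu> \<le> L" "1 \<le> \<alpha>"
  shows "bbs_n d L \<mu> \<alpha> + 1 \<le> 3 * (\<alpha> * sqrt (real d * L / \<mu>))"
proof -
  define s where "s = sqrt (real d * L / \<mu>)"
  have "1 * \<mu> \<le> real d * L" using assms by (intro mult_mono) auto
  then have s: "1 \<le> s" using assms by (simp add: s_def)
  have "of_int \<lceil>s\<rceil> \<le> 2 * s" using s of_int_ceiling_le_add_one[of s] by linarith
  then have "\<alpha> * of_int \<lceil>s\<rceil> \<le> \<alpha> * (2 * s)" using assms by (intro mult_left_mono) auto
  moreover have "1 * 1 \<le> \<alpha> * s" using s assms by (intro mult_mono) auto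
  ultimately show ?thesis unfolding bbs_n_def s_def[symmetric] by simp
qed

lemma bbs_execution_degenerate:
  assumes exec: "bbs_execution f L \<mu> \<alpha> \<epsilon> l l b B" and \<epsilon>: "0 < \<epsilon>"
  shows "B k = b k"
proof (induction k)
  case 0
  then show ?case using exec by (simp add: bbs_execution_def)
next
  case (Suc k)
  then have "\<not> \<epsilon> \<le> norm (B k - b k)" using \<epsilon> by simp
  then show ?case using exec Suc by (simp add: bbs_execution_def)
qed

lemma bbs_execution_oracle_calls_le:
  fixes l u :: "real ^ 'n"
  assumes exec: "bbs_execution f L \<mu> \<alpha> \<epsilon> l u b B"
    and q: "quadratic_growth_min f l u xstar L \<mu>" and \<alpha>: "1 < \<alpha>" and \<epsilon>: "0 < \<epsilon>"
    and run: "\<epsilon> \<le> norm (B k - b k)"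
  shows "real (bbs_oracle_calls L \<mu> \<alpha> (b k) (B k))
           \<le> 3 ^ CARD('n) * (\<alpha> * sqrt (real CARD('n) * L / \<mu>)) ^ CARD('n)"
proof -
  have pos: "0 < L" "0 < \<mu>" and xs: "xstar \<in> cbox l u"
    using q by (auto simp: quadratic_growth_min_def)
  have le: "l $ j \<le> u $ j" for j using xs by (auto simp: mem_box_cart intro: order_trans)
  have n0: "0 < bbs_n CARD('n) L \<mu> \<alpha>" using pos \<alpha> by (intro bbs_n_pos) auto
  have "l \<noteq> u" using bbs_execution_degenerate exec \<epsilon> run by fastforce
  then have "\<mu> \<le> L" using q quadratic_growth_min_constants_le by blast
  then have n: "bbs_n CARD('n) L \<mu> \<alpha> + 1 \<le> 3 * (\<alpha> * sqrt (real CARD('n) * L / \<mu>))"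
    using pos \<alpha> by (intro bbs_n_add_one_le) auto
  have "real (bbs_oracle_calls L \<mu> \<alpha> (b k) (B k)) \<le> (bbs_n CARD('n) L \<mu> \<alpha> + 1) ^ CARD('n)"
    using bbs_execution_ordered[OF exec le n0] \<alpha> n0 by (intro bbs_oracle_calls_le) auto
  also have "\<dots> \<le> (3 * (\<alpha> * sqrt (real CARD('n) * L / \<mu>))) ^ CARD('n)"
    using n n0 by (intro power_mono) auto
  finally show ?thesis by (simp only: power_mult_distrib)
qed

section \<open>Complexity of the algorithm\<close>

theorem corollary1:
  shows
    "(\<exists>K>0. \<forall>(\<alpha>::real) (l :: real ^ 'n) u. 1 < \<alpha> \<longrightarrow>
        (\<forall>\<^sub>F \<epsilon> in at_right 0. \<forall>f xstar L \<mu> b B.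
           quadratic_growth_min f l u xstar L \<mu> \<longrightarrow>
           bbs_execution f L \<mu> \<alpha> \<epsilon> l u b B \<longrightarrow>
           (\<exists>N. bbs_halts_after \<epsilon> b B N \<and> real N \<le> K * log \<alpha> (1 / \<epsilon>)))) \<and>
     (\<exists>K>0. \<forall>(\<alpha>::real) (l :: real ^ 'n) u \<epsilon> f xstar L \<mu> b B.
        1 < \<alpha> \<longrightarrow> 0 < \<epsilon> \<longrightarrow>
        quadratic_growth_min f l u xstar L \<mu> \<longrightarrow>
        bbs_execution f L \<mu> \<alpha> \<epsilon> l u b B \<longrightarrow>
        (\<forall>k. \<epsilon> \<le> norm (B k - b k) \<longrightarrow>
           real (bbs_oracle_calls L \<mu> \<alpha> (b k) (B k))
             \<le> K * (\<alpha> * sqrt (real CARD('n) * L / \<mu>)) ^ CARD('n)))"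
proof (intro conjI)
  show "\<exists>K>0. \<forall>(\<alpha>::real) (l :: real ^ 'n) u. 1 < \<alpha> \<longrightarrow>
        (\<forall>\<^sub>F \<epsilon> in at_right 0. \<forall>f xstar L \<mu> b B.
           quadratic_growth_min f l u xstar L \<mu> \<longrightarrow>
           bbs_execution f L \<mu> \<alpha> \<epsilon> l u b B \<longrightarrow>
           (\<exists>N. bbs_halts_after \<epsilon> b B N \<and> real N \<le> K * log \<alpha> (1 / \<epsilon>)))"
  proof (intro exI[of _ 2] conjI allI impI)
    fix \<alpha> :: real and l u :: "real ^ 'n"
    assume \<alpha>: "1 < \<alpha>"
    define e where "e = 1 / (\<alpha> * (real CARD('n) * norm (u - l)) + 1)"
    have "0 < e" using \<alpha> by (simp add: e_def add_nonneg_pos)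
    show "\<forall>\<^sub>F \<epsilon> in at_right 0. \<forall>f xstar L \<mu> b B.
           quadratic_growth_min f l u xstar L \<mu> \<longrightarrow>
           bbs_execution f L \<mu> \<alpha> \<epsilon> l u b B \<longrightarrow>
           (\<exists>N. bbs_halts_after \<epsilon> b B N \<and> real N \<le> 2 * log \<alpha> (1 / \<epsilon>))"
      using eventually_at_right_real[OF \<open>0 < e\<close>]
    proof eventually_elim
      case (elim \<epsilon>)
      show ?case
      proof (intro allI impI)
        fix f xstar L \<mu> b B
        assume q: "quadratic_growth_min f l u xstar L \<mu>"
          and exec: "bbs_execution f L \<mu> \<alpha> \<epsilon> l u b B"
        have le: "l $ j \<le> u $ j" for j
          using q by (auto simp: quadratic_growth_min_def mem_box_cart intro: order_trans)
        show "\<exists>N. bbs_halts_after \<epsilon> b B N \<and> real N \<le> 2 * log \<alpha> (1 / \<epsilon>)"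
          using bbs_halting_time[OF exec le _ _ \<alpha>] q elim
          by (auto simp: quadratic_growth_min_def e_def)
      qed
    qed
  qed simp
next
  show "\<exists>K>0. \<forall>(\<alpha>::real) (l :: real ^ 'n) u \<epsilon> f xstar L \<mu> b B.
        1 < \<alpha> \<longrightarrow> 0 < \<epsilon> \<longrightarrow>
        quadratic_growth_min f l u xstar L \<mu> \<longrightarrow>
        bbs_execution f L \<mu> \<alpha> \<epsilon> l u b B \<longrightarrow>
        (\<forall>k. \<epsilon> \<le> norm (B k - b k) \<longrightarrow>
           real (bbs_oracle_calls L \<mu> \<alpha> (b k) (B k))
             \<le> K * (\<alpha> * sqrt (real CARD('n) * L / \<mu>)) ^ CARD('n))"
    by (intro exI[of _ "3 ^ CARD('n)"]) (auto intro: bbs_execution_oracle_calls_le)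
qed

end
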